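(* As $n\to\infty$ through the positive integers, the number of prime numbers in the interval $[4n,5n]$ goes to infinity. That is, for every positive integer $m$ there exists a positive integer $L$ such that for all integers $n\geq L$ there are at least $m$ prime numbers in the interval $[4n,5n]$. *)

theory Defs
  imports Complex_Main "HOL-Computational_Algebra.Primes"
begin

end

(* Chebyshev's method. With T n = ln n! and psi the summatory function of the von Mangoldt
   function, E n = T n - T (n/2) - T (n/3) - T (n/5) + T (n/30) satisfies
   psi n - psi (n/6) <= E n <= psi n, while Stirling's formula gives E n = A n + O(ln n) with
   A > 0. Iterating, A n <~ psi n <~ (6/5) A n, and as 6/5 < 5/4 this makes
   psi (5 n) - psi (4 n) grow linearly. The proper prime powers in (4 n, 5 n] contribute only
   O(sqrt n ln n) to it, so the number of primes there tends to infinity. *)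

theory Submission
  imports Defs "HOL-Number_Theory.Prime_Powers"
begin

section \<open>Chebyshev's function and its link with factorials\<close>

definition psi :: "nat \<Rightarrow> real" where
  "psi n = (\<Sum>d\<in>{0<..n}. mangoldt d)"

lemma psi_mono: "m \<le> n \<Longrightarrow> psi m \<le> psi n"
  unfolding psi_def by (intro sum_mono2) (auto simp: mangoldt_nonneg)

lemma psi_diff: "m \<le> n \<Longrightarrow> psi n - psi m = (\<Sum>d\<in>{m<..n}. mangoldt d)"
proof -
  assume "m \<le> n"
  then have "{0<..n} = {0<..m} \<union> {m<..n}" by auto
  then show ?thesis
    unfolding psi_def by (simp add: sum.union_disjoint)
qed

lemma ln_fact_Suc: "ln (fact (Suc n) :: real) = ln (fact n) + ln (real n + 1)"
  using ln_mult[of "fact n :: real" "real n + 1"] by (simp add: algebra_simps)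

text \<open>Passing from \<open>n\<close> to \<open>Suc n\<close> raises \<open>n div d\<close> by
  one exactly when \<open>d\<close> divides \<open>Suc n\<close>, and \<open>mangoldt\<close> summed
  over these divisors is \<open>ln (Suc n)\<close>. The free bound \<open>N\<close> lets all
  factorials in \<open>cheb\<close> be expanded over one range.\<close>

lemma ln_fact_eq_sum_mangoldt:
  assumes "n \<le> N"
  shows "ln (fact n :: real) = (\<Sum>d\<in>{0<..N}. mangoldt d * real (n div d))"
  using assms
proof (induction n)
  case (Suc n)
  have "(\<Sum>d\<in>{0<..N}. mangoldt d * real (Suc n div d)) =
        (\<Sum>d\<in>{0<..N}. mangoldt d * real (n div d) + (if d dvd Suc n then mangoldt d else 0))"
    by (intro sum.cong) (auto simp: div_Suc mod_eq_0_iff_dvd algebra_simps)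
  also have "\<dots> = ln (fact n) + (\<Sum>d\<in>{d\<in>{0<..N}. d dvd Suc n}. mangoldt d)"
    using Suc by (subst sum.inter_filter) (auto simp: sum.distrib)
  also have "{d\<in>{0<..N}. d dvd Suc n} = {d. d dvd Suc n}"
    using Suc.prems by (auto dest: dvd_imp_le intro!: Nat.gr0I)
  also have "(\<Sum>d | d dvd Suc n. mangoldt d :: real) = ln (real (Suc n))"
    by (subst mangoldt_sum) auto
  also have "ln (fact n) + ln (real (Suc n)) = ln (fact (Suc n) :: real)"
    by (simp add: ln_fact_Suc add.commute del: fact_Suc)
  finally show ?case by simp
qed auto

section \<open>Stirling's formula with logarithmic error\<close>

lemma ln_diff_bounds:
  fixes x y :: real
  assumes "0 < x" "x \<le> y"
  shows "y - x \<le> y * (ln y - ln x)" and "x * (ln y - ln x) \<le> y - x"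
proof -
  have "ln (x / y) \<le> x / y - 1" "ln (y / x) \<le> y / x - 1"
    using assms by (auto intro!: ln_le_minus_one)
  then show "y - x \<le> y * (ln y - ln x)" and "x * (ln y - ln x) \<le> y - x"
    using assms by (auto simp: ln_div field_simps)
qed

text \<open>Each induction step compares the increment of a bound with \<open>ln (n + 1)\<close>;
  both comparisons are \<open>ln_diff_bounds\<close> at \<open>n\<close> and
  \<open>n + 1\<close>.\<close>

lemma ln_fact_bounds:
  assumes "n \<ge> 1"
  shows "real n * ln n - n \<le> ln (fact n)" and "ln (fact n) \<le> (real n + 1) * ln n - n + 1"
proof -
  have "real n * ln n - n \<le> ln (fact n) \<and> ln (fact n) \<le> (real n + 1) * ln n - n + 1"
    using assms
  proof (induction n rule: nat_induct_at_least)
    case (Suc n)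
    with ln_fact_Suc[of n] ln_diff_bounds[of "real n" "real n + 1"] show ?case
      by (simp add: algebra_simps)
  qed auto
  then show "real n * ln n - n \<le> ln (fact n)" and "ln (fact n) \<le> (real n + 1) * ln n - n + 1"
    by auto
qed

lemma x_ln_x_minus_x_mono:
  fixes x y :: real
  assumes "1 \<le> x" "x \<le> y"
  shows "x * ln x - x \<le> y * ln y - y"
proof -
  have "0 \<le> (y - x) * ln x" using assms by simp
  with ln_diff_bounds(1)[of x y] assms show ?thesis by (simp add: algebra_simps)
qed

lemma ln_fact_div_approx:
  fixes n k :: nat
  assumes "1 \<le> k" "k \<le> n"
  shows "\<bar>ln (fact (n div k)) - (real n / k * ln (real n / k) - real n / k)\<bar> \<le> ln (real n + 1) + 1"
proof -
  define m where "m = n div k"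
  define x where "x = real n / k"
  have m1: "1 \<le> m" using assms by (simp add: m_def Suc_le_eq div_greater_zero_iff)
  have mx: "real m \<le> x" by (simp add: m_def x_def of_nat_div_le_of_nat)
  have xm: "x \<le> real m + 1"
  proof -
    have "n \<le> k + m * k" using dividend_less_div_times[of k n] assms by (simp add: m_def)
    then have "real n \<le> real (k + m * k)" by (simp only: of_nat_le_iff)
    then show ?thesis using assms by (simp add: x_def field_simps)
  qed
  have mn: "m \<le> n" by (simp add: m_def)
  \<comment> \<open>Since \<open>x\<close> may exceed \<open>m\<close>, the lower estimate is taken
    at \<open>m + 1\<close> and \<open>ln (m + 1)\<close> is given back.\<close>
  have "ln (fact (Suc m) :: real) = ln (fact m) + ln (real m + 1)"
    by (rule ln_fact_Suc)
  moreover have "(real m + 1) * ln (real m + 1) - (real m + 1) \<le> ln (fact (Suc m))"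
    using ln_fact_bounds(1)[of "Suc m"] by (simp add: add.commute del: fact_Suc)
  moreover have "x * ln x - x \<le> (real m + 1) * ln (real m + 1) - (real m + 1)"
    using m1 mx xm by (intro x_ln_x_minus_x_mono) auto
  moreover have "ln (real m + 1) \<le> ln (real n + 1)" "ln (real m) \<le> ln (real n + 1)"
    using mn m1 by auto
  moreover have "ln (fact m) \<le> (real m + 1) * ln m - m + 1"
    using m1 by (rule ln_fact_bounds)
  moreover have "real m * ln m - m \<le> x * ln x - x"
    using x_ln_x_minus_x_mono[of m x] m1 mx by simp
  ultimately show ?thesis
    unfolding m_def [symmetric] x_def [symmetric] abs_le_iff distrib_right by linarith
qed

section \<open>Chebyshev's combination of factorials\<close>

definition cheb :: "nat \<Rightarrow> real" where
  "cheb n = ln (fact n) - ln (fact (n div 2)) - ln (fact (n div 3)) - ln (fact (n div 5))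
              + ln (fact (n div 30))"

text \<open>As 1 - 1/2 - 1/3 - 1/5 + 1/30 = 0, the expression has period 30 in \<open>q\<close>, so
  checking the residues is enough.\<close>

lemma cheb_coeff_bounds:
  fixes q :: nat
  shows "int q - int (q div 2) - int (q div 3) - int (q div 5) + int (q div 30) \<in> {0..1}"
    and "1 \<le> q \<Longrightarrow> q < 6 \<Longrightarrow>
      int q - int (q div 2) - int (q div 3) - int (q div 5) + int (q div 30) = 1"
proof -
  define a r where "a = q div 30" and "r = q mod 30"
  have q: "q = r + 30 * a" by (simp add: a_def r_def)
  have "r \<in> {..<30}" by (simp add: r_def)
  then have "int r - int (r div 2) - int (r div 3) - int (r div 5) \<in> {0..1}"
    unfolding lessThan_nat_numeral by (auto simp: lessThan_Suc)
  moreover have "q div 2 = r div 2 + 15 * a" "q div 3 = r div 3 + 10 * a" "q div 5 = r div 5 + 6 * a"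
    unfolding q by linarith+
  ultimately show "int q - int (q div 2) - int (q div 3) - int (q div 5) + int (q div 30) \<in> {0..1}"
    unfolding atLeastAtMost_iff using q a_def by linarith
next
  assume "1 \<le> q" "q < 6"
  then have "q \<in> {1, 2, 3, 4, 5}" by auto
  then show "int q - int (q div 2) - int (q div 3) - int (q div 5) + int (q div 30) = 1"
    by auto
qed

text \<open>Floor divisions commute, so the coefficient of \<open>mangoldt d\<close> depends only on
  \<open>n div d\<close>.\<close>

lemma cheb_eq_sum:
  "cheb n = (\<Sum>d\<in>{0<..n}. mangoldt d *
     of_int (int (n div d) - int (n div d div 2) - int (n div d div 3) - int (n div d div 5)
              + int (n div d div 30)))"
proof -
  have "n div k div d = n div d div k" for k d
    by (simp add: div_mult2_eq [symmetric] mult.commute)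
  then show ?thesis
    unfolding cheb_def
    by (simp add: ln_fact_eq_sum_mangoldt[of _ n] sum.distrib sum_subtractf algebra_simps)
qed

lemma cheb_le_psi: "cheb n \<le> psi n"
  unfolding cheb_eq_sum psi_def
proof (intro sum_mono)
  fix d
  show "mangoldt d * of_int (int (n div d) - int (n div d div 2) - int (n div d div 3)
          - int (n div d div 5) + int (n div d div 30)) \<le> (mangoldt d :: real)"
    using cheb_coeff_bounds(1)[of "n div d"] mangoldt_nonneg[of d]
    by (intro mult_left_le) (auto simp del: of_int_diff of_int_add)
qed

text \<open>For \<open>d\<close> in \<open>{n div 6<..n}\<close> the quotient \<open>n div d\<close>
  lies between 1 and 5, where the coefficient is 1; the remaining terms of \<open>cheb n\<close> are
  nonnegative.\<close>

lemma psi_minus_psi_le_cheb: "psi n - psi (n div 6) \<le> cheb n"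
proof -
  define a where "a q = int q - int (q div 2) - int (q div 3) - int (q div 5) + int (q div 30)"
    for q :: nat
  have a01: "a q \<in> {0..1}" for q
    using cheb_coeff_bounds(1) by (simp add: a_def)
  have "psi n - psi (n div 6) = (\<Sum>d\<in>{n div 6<..n}. mangoldt d)"
    by (rule psi_diff) simp
  also have "\<dots> = (\<Sum>d\<in>{n div 6<..n}. mangoldt d * of_int (a (n div d)))"
  proof (intro sum.cong refl)
    fix d assume d: "d \<in> {n div 6<..n}"
    then have "1 \<le> n div d" by (simp add: Suc_le_eq div_greater_zero_iff)
    moreover have "n div d < 6" using d by (simp add: div_less_iff_less_mult)
    ultimately have "a (n div d) = 1" using cheb_coeff_bounds(2) by (simp add: a_def)
    then show "mangoldt d = (mangoldt d * of_int (a (n div d)) :: real)" by simp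
  qed
  also have "\<dots> \<le> (\<Sum>d\<in>{0<..n}. mangoldt d * of_int (a (n div d)))"
    using a01 by (intro sum_mono2) (auto intro!: mult_nonneg_nonneg mangoldt_nonneg)
  also have "\<dots> = cheb n" by (simp add: cheb_eq_sum a_def)
  finally show ?thesis .
qed

section \<open>Asymptotics of the combination\<close>

definition cheb_const :: real where
  "cheb_const = ln 2 / 2 + ln 3 / 3 + ln 5 / 5 - ln 30 / 30"

lemma cheb_const_pos: "cheb_const > 0"
proof -
  have "ln (30 :: real) = ln 2 + ln 3 + ln 5"
    using ln_mult[of 2 "15::real"] ln_mult[of 3 "5::real"] by simp
  moreover have "ln (2::real) > 0" "ln (3::real) > 0" "ln (5::real) > 0" by simp_all
  ultimately show ?thesis unfolding cheb_const_def by linarith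
qed

text \<open>Because 1 - 1/2 - 1/3 - 1/5 + 1/30 = 0, the \<open>n * ln n\<close> terms and the linear
  Stirling terms cancel. What remains are the terms \<open>n * ln k / k\<close>, which make up
  \<open>cheb_const\<close>, and five rounding errors.\<close>

lemma cheb_approx:
  assumes "n \<ge> 30"
  shows "\<bar>cheb n - cheb_const * n\<bar> \<le> 5 * (ln (real n + 1) + 1)"
proof -
  define g where "g k = real n / k * ln (real n / k) - real n / k" for k :: real
  have approx: "\<bar>ln (fact (n div k)) - g (real k)\<bar> \<le> ln (real n + 1) + 1" if "1 \<le> k" "k \<le> 30" for k
    using ln_fact_div_approx[of k n] that assms by (simp add: g_def)
  have "g 1 - g 2 - g 3 - g 5 + g 30 = cheb_const * n"
    using assms by (simp add: g_def cheb_const_def ln_div field_simps)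
  then show ?thesis
    using approx[of 1] approx[of 2] approx[of 3] approx[of 5] approx[of 30]
    unfolding cheb_def by (simp add: abs_le_iff)
qed

lemma ln_le_two_sqrt:
  fixes x :: real
  assumes "x > 0"
  shows "ln x \<le> 2 * sqrt x - 2"
  using ln_le_minus_one[of "sqrt x"] assms by (simp add: ln_sqrt)

lemma cheb_eventually:
  assumes "\<epsilon> > 0"
  shows "\<forall>\<^sub>F n in sequentially. \<bar>cheb n - cheb_const * n\<bar> \<le> \<epsilon> * real n"
proof -
  \<comment> \<open>The error in \<open>cheb_approx\<close> is at most \<open>20 * sqrt n\<close>,
    so this threshold suffices.\<close>
  have "\<forall>\<^sub>F n in sequentially. 30 / \<epsilon> \<le> sqrt (real n)"
    using filterlim_compose[OF sqrt_at_top filterlim_real_sequentially]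
    by (simp add: filterlim_at_top)
  then show ?thesis
    using eventually_ge_at_top[of 30]
  proof eventually_elim
    case (elim n)
    have "ln (real n + 1) \<le> 2 * sqrt (real n + 1) - 2"
      by (rule ln_le_two_sqrt) simp
    moreover have "sqrt (real n + 1) \<le> sqrt (4 * real n)"
      using elim by (intro real_sqrt_le_mono) simp
    then have "sqrt (real n + 1) \<le> 2 * sqrt (real n)" by (simp add: real_sqrt_mult)
    moreover have "30 * sqrt (real n) \<le> \<epsilon> * sqrt (real n) * sqrt (real n)"
      using elim assms by (intro mult_right_mono) (auto simp: field_simps)
    then have "30 * sqrt (real n) \<le> \<epsilon> * real n" by (simp add: mult.assoc)
    moreover have "0 \<le> sqrt (real n)" by simp
    ultimately have "5 * (ln (real n + 1) + 1) \<le> \<epsilon> * real n" by argo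
    with cheb_approx[OF elim(2)] show ?case by linarith
  qed
qed

section \<open>Linear bounds for \<open>psi\<close>\<close>

text \<open>Iterating the bound on \<open>psi n - psi (n div 6)\<close> costs only the factor
  $1 + 1/6 + 1/36 + \dots = 6/5$, which is less than $5/4$.\<close>

lemma psi_upper:
  assumes "\<epsilon> > 0"
  obtains K where "\<And>n. psi n \<le> 6 / 5 * (cheb_const + \<epsilon>) * real n + K"
proof -
  obtain N where N: "\<And>n. n \<ge> N \<Longrightarrow> \<bar>cheb n - cheb_const * n\<bar> \<le> \<epsilon> * real n"
    using cheb_eventually[OF assms] by (auto simp: eventually_sequentially)
  define B where "B = cheb_const + \<epsilon>"
  have B: "B > 0" using assms cheb_const_pos by (simp add: B_def)
  have "psi n \<le> 6 / 5 * B * real n + psi (Suc N)" for n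
  proof (induction n rule: less_induct)
    case (less n)
    show ?case
    proof (cases "n \<le> Suc N")
      case True
      then have "psi n \<le> psi (Suc N)" by (rule psi_mono)
      moreover have "0 \<le> 6 / 5 * B * real n" using B by simp
      ultimately show ?thesis by linarith
    next
      case False
      have "psi n \<le> psi (n div 6) + cheb n"
        using psi_minus_psi_le_cheb[of n] by simp
      also have "cheb n \<le> B * real n"
        using N[of n] False by (simp add: B_def algebra_simps)
      also have "psi (n div 6) \<le> 6 / 5 * B * real (n div 6) + psi (Suc N)"
        using False by (intro less.IH) auto
      \<comment> \<open>The factor 6/5 reproduces itself: B + (6/5) B / 6 = (6/5) B. The additive
        constant is passed on unchanged.\<close>
      also have "6 / 5 * B * real (n div 6) \<le> 6 / 5 * B * (real n / 6)"
        using B of_nat_div_le_of_nat[of n 6, where 'a = real] by (intro mult_left_mono) auto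
      finally show ?thesis by (simp add: algebra_simps)
    qed
  qed
  then show ?thesis by (intro that[of "psi (Suc N)"]) (simp add: B_def)
qed

lemma psi_diff_lower:
  obtains K where
    "\<forall>\<^sub>F n in sequentially. psi (5 * n) - psi (4 * n) \<ge> cheb_const / 10 * real n - K"
proof -
  \<comment> \<open>With A = \<open>cheb_const\<close>, the bounds below give 5 (A - \<epsilon>) -
    (24/5) (A + \<epsilon>) = A/5 - (49/5) \<epsilon> as the slope; this \<epsilon> uses up half of
    A/5.\<close>
  define \<epsilon> where "\<epsilon> = cheb_const / 98"
  have \<epsilon>: "\<epsilon> > 0" using cheb_const_pos by (simp add: \<epsilon>_def)
  obtain K where K: "\<And>n. psi n \<le> 6 / 5 * (cheb_const + \<epsilon>) * real n + K"
    using psi_upper[OF \<epsilon>] by blast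
  have "filterlim (\<lambda>n::nat. 5 * n) sequentially sequentially"
    by (rule mult_nat_left_at_top) simp
  from eventually_compose_filterlim[OF cheb_eventually[OF \<epsilon>] this]
  have "\<forall>\<^sub>F n in sequentially. psi (5 * n) - psi (4 * n) \<ge> cheb_const / 10 * real n - K"
  proof eventually_elim
    case (elim n)
    then have "psi (5 * n) \<ge> (cheb_const - \<epsilon>) * (5 * real n)"
      using cheb_le_psi[of "5 * n"] by (simp add: algebra_simps)
    moreover have "psi (4 * n) \<le> 6 / 5 * (cheb_const + \<epsilon>) * (4 * real n) + K"
      using K[of "4 * n"] by simp
    ultimately show ?case by (simp add: \<epsilon>_def algebra_simps)
  qed
  then show ?thesis by (rule that)
qed

section \<open>From \<open>psi\<close> to the number of primes\<close>

text \<open>A prime has at most one power in the interval, since its consecutive powers differ at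
  least by a factor of 2.\<close>

lemma card_nonprime_primepow_le:
  "real (card {d \<in> {4 * n<..5 * n}. primepow d \<and> \<not> prime d}) \<le> sqrt (5 * real n)"
proof -
  define S where "S = {d \<in> {4 * n<..5 * n}. primepow d \<and> \<not> prime d}"
  have S: "\<exists>p k. prime p \<and> k \<ge> 2 \<and> d = p ^ k \<and> aprimedivisor d = p" if "d \<in> S" for d
  proof -
    from that obtain p k where pk: "prime p" "k > 0" "d = p ^ k"
      by (auto simp: S_def primepow_def)
    moreover have "k \<noteq> 1" using pk that by (auto simp: S_def)
    ultimately show ?thesis
      by (intro exI[of _ p] exI[of _ k]) (auto simp: aprimedivisor_prime_power)
  qed
  have "inj_on aprimedivisor S"
  proof (rule linorder_inj_onI')
    fix d e assume de: "d \<in> S" "e \<in> S" "d < e"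
    show "aprimedivisor d \<noteq> aprimedivisor e"
    proof
      assume "aprimedivisor d = aprimedivisor e"
      then obtain p k l where p: "prime p" "d = p ^ k" "e = p ^ l"
        using S[OF de(1)] S[OF de(2)] by auto
      have p2: "p \<ge> 2" using p(1) by (rule prime_ge_2_nat)
      then have "k < l" using de(3) p by (simp add: power_less_imp_less_exp)
      then have "p ^ Suc k \<le> p ^ l" using p2 by (intro power_increasing) auto
      then have "p * d \<le> e" using p by simp
      moreover have "2 * d \<le> p * d" using p2 by simp
      moreover have "e \<le> 5 * n" "4 * n < d" using de by (auto simp: S_def)
      ultimately show False by linarith
    qed
  qed
  \<comment> \<open>A prime power that is not prime has exponent at least 2, so its base is at most
    the square root of \<open>5 * n\<close>.\<close>
  moreover have "aprimedivisor ` S \<subseteq> {0<..nat \<lfloor>sqrt (5 * real n)\<rfloor>}"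
  proof
    fix p assume "p \<in> aprimedivisor ` S"
    then obtain d k where pk: "d \<in> S" "prime p" "k \<ge> 2" "d = p ^ k" using S by blast
    have "p ^ 2 \<le> p ^ k" using pk prime_gt_0_nat by (intro power_increasing) (auto simp: Suc_le_eq)
    also have "\<dots> \<le> 5 * n" using pk by (auto simp: S_def)
    finally have "real p ^ 2 \<le> 5 * real n"
      by (simp flip: of_nat_power of_nat_le_iff[where ?'a = real])
    then have "real p \<le> sqrt (5 * real n)" by (rule real_le_rsqrt)
    then show "p \<in> {0<..nat \<lfloor>sqrt (5 * real n)\<rfloor>}"
      using prime_gt_0_nat[OF pk(2)] by (simp add: le_nat_floor)
  qed
  ultimately have "card S \<le> card {0<..nat \<lfloor>sqrt (5 * real n)\<rfloor>}"
    by (intro card_inj_on_le) auto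
  then have "real (card S) \<le> real (nat \<lfloor>sqrt (5 * real n)\<rfloor>)"
    by (simp only: card_greaterThanAtMost diff_zero of_nat_le_iff)
  also have "\<dots> \<le> sqrt (5 * real n)" by (rule of_nat_floor) simp
  finally show ?thesis by (simp add: S_def)
qed

text \<open>\<open>mangoldt\<close> vanishes off the prime powers and is at most
  \<open>ln (5 * n)\<close> on the interval, so it suffices to count primes and proper prime
  powers.\<close>

lemma psi_diff_le_card_primes:
  assumes "n \<ge> 1"
  shows "psi (5 * n) - psi (4 * n) \<le>
    (real (card {p::nat. prime p \<and> p \<in> {4 * n..5 * n}}) + sqrt (5 * real n)) * ln (5 * real n)"
proof -
  define P where "P = {p::nat. prime p \<and> p \<in> {4 * n..5 * n}}"
  define S where "S = {d \<in> {4 * n<..5 * n}. primepow d \<and> \<not> prime d}"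
  have fin: "finite P" "finite S" by (auto simp: P_def S_def)
  have bound: "mangoldt d \<le> ln (5 * real n)" if "0 < d" "d \<le> 5 * n" for d
  proof -
    have "mangoldt d \<le> ln (real d)" using that by (intro mangoldt_le)
    also have "real d \<le> real (5 * n)" using that by (simp only: of_nat_le_iff)
    then have "ln (real d) \<le> ln (5 * real n)" using that by simp
    finally show ?thesis .
  qed
  have "psi (5 * n) - psi (4 * n) = (\<Sum>d\<in>{4 * n<..5 * n}. mangoldt d)"
    by (rule psi_diff) simp
  also have "\<dots> = (\<Sum>d\<in>{d \<in> {4 * n<..5 * n}. primepow d}. mangoldt d)"
    by (rule sum.mono_neutral_right) (auto simp: mangoldt_def)
  \<comment> \<open>An inequality suffices here: \<open>P\<close> comes from the closed interval,
    the sum from the half-open one.\<close>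
  also have "\<dots> \<le> (\<Sum>d\<in>P \<union> S. mangoldt d)"
    using fin by (intro sum_mono2) (auto simp: P_def S_def mangoldt_nonneg)
  also have "\<dots> \<le> real (card (P \<union> S)) * ln (5 * real n)"
    using assms by (intro sum_bounded_above bound) (auto simp: P_def S_def prime_gt_0_nat)
  also have "\<dots> \<le> (real (card P) + sqrt (5 * real n)) * ln (5 * real n)"
  proof (rule mult_right_mono)
    show "real (card (P \<union> S)) \<le> real (card P) + sqrt (5 * real n)"
      using card_Un_le[of P S] card_nonprime_primepow_le[of n] by (simp add: S_def)
    show "0 \<le> ln (5 * real n)" using assms by simp
  qed
  finally show ?thesis by (simp add: P_def)
qed

text \<open>In terms of s, the fourth root of \<open>5 * n\<close>, the logarithm is at most 4 s.
  The left side is then of order s^3, against c s^4 on the right.\<close>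

lemma sqrt_times_ln_less_linear:
  fixes c m K :: real
  assumes "c > 0" "m \<ge> 0"
  shows "\<forall>\<^sub>F n in sequentially. (m + sqrt (5 * real n)) * ln (5 * real n) + K < c * (5 * real n)"
proof -
  have "filterlim (\<lambda>n. sqrt (sqrt (5 * real n))) at_top sequentially"
    by (intro filterlim_compose[OF sqrt_at_top] filterlim_real_sequentially
          filterlim_tendsto_pos_mult_at_top[OF tendsto_const]) simp
  \<comment> \<open>Once s is at least 1, the terms on the left are at most 4 m, 4 and
    \<open>\<bar>K\<bar>\<close> times s^3; the extra 1 makes the inequality strict.\<close>
  then have "\<forall>\<^sub>F n in sequentially. max 1 ((4 * m + 4 + \<bar>K\<bar> + 1) / c) \<le> sqrt (sqrt (5 * real n))"
    unfolding filterlim_at_top by blast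
  then show ?thesis
    using eventually_ge_at_top[of 1]
  proof eventually_elim
    case (elim n)
    define s where "s = sqrt (sqrt (5 * real n))"
    have s1: "1 \<le> s" and sc: "4 * m + 4 + \<bar>K\<bar> + 1 \<le> c * s"
      using elim assms by (simp_all add: s_def field_simps)
    have s2: "sqrt (5 * real n) = s ^ 2" by (simp add: s_def)
    have "5 * real n = (sqrt (5 * real n)) ^ 2" by simp
    then have s4: "5 * real n = s ^ 4" by (simp add: s2 flip: power_mult)
    have "ln (5 * real n) \<le> 4 * s"
      using ln_le_two_sqrt[of "sqrt (5 * real n)"] elim by (simp add: s_def ln_sqrt)
    then have "(m + sqrt (5 * real n)) * ln (5 * real n) \<le> (m + s ^ 2) * (4 * s)"
      unfolding s2 using assms by (intro mult_left_mono) auto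
    moreover have "(m + s ^ 2) * (4 * s) = 4 * m * s + 4 * s ^ 3"
      by (simp add: algebra_simps power2_eq_square power3_eq_cube)
    moreover have "s \<le> s ^ 3" and s3: "1 \<le> s ^ 3"
      using s1 power_increasing[of 1 3 s] by auto
    then have "4 * m * s \<le> 4 * m * s ^ 3" using assms by (intro mult_left_mono) auto
    moreover have "K \<le> \<bar>K\<bar> * s ^ 3"
      using mult_left_mono[OF s3, of "\<bar>K\<bar>"] by linarith
    moreover have "(4 * m + 4 + \<bar>K\<bar> + 1) * s ^ 3 \<le> c * s * s ^ 3"
      using sc s1 by (intro mult_right_mono) auto
    then have "4 * m * s ^ 3 + 4 * s ^ 3 + \<bar>K\<bar> * s ^ 3 + s ^ 3 \<le> c * s ^ 4"
      by (simp add: algebra_simps power3_eq_cube power4_eq_xxxx)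
    ultimately show ?case
      using s3 unfolding s4 [symmetric] by linarith
  qed
qed

text \<open>The upper bound for \<open>psi (5 * n) - psi (4 * n)\<close>, with \<open>m\<close> in
  place of the prime count, eventually falls below the linear lower bound. Cancelling the logarithm
  leaves \<open>m\<close> below the count.\<close>

lemma filterlim_card_primes_at_top:
  "filterlim (\<lambda>n::nat. card {p::nat. prime p \<and> p \<in> {4 * n..5 * n}}) at_top at_top"
  unfolding filterlim_at_top
proof
  fix m :: nat
  let ?c = "\<lambda>n::nat. card {p::nat. prime p \<and> p \<in> {4 * n..5 * n}}"
  obtain K where
    K: "\<forall>\<^sub>F n in sequentially. psi (5 * n) - psi (4 * n) \<ge> cheb_const / 10 * real n - K"
    by (rule psi_diff_lower)
  have "\<forall>\<^sub>F n in sequentially.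
      (real m + sqrt (5 * real n)) * ln (5 * real n) + K < cheb_const / 50 * (5 * real n)"
    using cheb_const_pos by (intro sqrt_times_ln_less_linear) auto
  then show "\<forall>\<^sub>F n in sequentially. m \<le> ?c n"
    using K eventually_ge_at_top[of 1]
  proof eventually_elim
    case (elim n)
    have "(real m + sqrt (5 * real n)) * ln (5 * real n)
            < (real (?c n) + sqrt (5 * real n)) * ln (5 * real n)"
      using elim(1,2) psi_diff_le_card_primes[OF elim(3)] by linarith
    moreover have "0 \<le> ln (5 * real n)" using elim by simp
    ultimately have "real m + sqrt (5 * real n) < real (?c n) + sqrt (5 * real n)"
      by (rule mult_right_less_imp_less)
    then show ?case by simp
  qed
qed

theorem theorem4p0p2:
  shows "filterlim (\<lambda>n::nat. card {p::nat. prime p \<and> p \<in> {4 * n..5 * n}}) at_top at_top \<and>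
    (\<forall>m::nat. m > 0 \<longrightarrow> (\<exists>L::nat. L > 0 \<and>
      (\<forall>n::nat. n \<ge> L \<longrightarrow> card {p::nat. prime p \<and> p \<in> {4 * n..5 * n}} \<ge> m)))"
proof (intro conjI allI impI)
  fix m :: nat
  have "\<forall>\<^sub>F n in sequentially. m \<le> card {p::nat. prime p \<and> p \<in> {4 * n..5 * n}}"
    using filterlim_card_primes_at_top by (simp add: filterlim_at_top)
  then obtain L where "\<And>n. n \<ge> L \<Longrightarrow> m \<le> card {p::nat. prime p \<and> p \<in> {4 * n..5 * n}}"
    by (auto simp: eventually_sequentially)
  then show "\<exists>L::nat. L > 0 \<and>
      (\<forall>n::nat. n \<ge> L \<longrightarrow> card {p::nat. prime p \<and> p \<in> {4 * n..5 * n}} \<ge> m)"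
    by (intro exI[of _ "Suc L"]) auto
qed (rule filterlim_card_primes_at_top)

end
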